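(* Let $D$ be an integral domain. If $\operatorname{CoSp}(D)\neq\varnothing$, then $D$ is a field.
   Context: All rings are commutative with identity. For ideals $I,J$ of a ring $A$, $\operatorname{Ann}(I)=\{a\in A\mid aI=0\}$ and $(J:I)=\{a\in A\mid aI\subseteq J\}$. The coproduct of $I$ and $J$ is the ideal $[I:J]:=(J:\operatorname{Ann}(I))=\{a\in A\mid a\operatorname{Ann}(I)\subseteq J\}$. An ideal $C$ of $A$ is coprime if $C\neq 0$ and, for all ideals $I,J$ of $A$, $C\subseteq [I:J]$ implies $C\subseteq I$ or $C\subseteq J$. $\operatorname{CoSp}(A)$ is the set of coprime ideals of $A$. *)

theory Defs
  imports "HOL-Algebra.Algebra"
begin

definition annihilator :: "('a, 'b) ring_scheme \<Rightarrow> 'a set \<Rightarrow> 'a set"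
  where "annihilator A I = {a \<in> carrier A. a <#\<^bsub>A\<^esub> I = {\<zero>\<^bsub>A\<^esub>}}"

(* ideal_colon A J I is (J : I). *)
definition ideal_colon :: "('a, 'b) ring_scheme \<Rightarrow> 'a set \<Rightarrow> 'a set \<Rightarrow> 'a set"
  where "ideal_colon A J I = {a \<in> carrier A. a <#\<^bsub>A\<^esub> I \<subseteq> J}"

(* ideal_coproduct A I J is [I : J] = (J : Ann(I)). *)
definition ideal_coproduct :: "('a, 'b) ring_scheme \<Rightarrow> 'a set \<Rightarrow> 'a set \<Rightarrow> 'a set"
  where "ideal_coproduct A I J = ideal_colon A J (annihilator A I)"

definition coprime_ideal :: "('a, 'b) ring_scheme \<Rightarrow> 'a set \<Rightarrow> bool"
  where "coprime_ideal A C \<longleftrightarrow>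
    ideal C A \<and> C \<noteq> {\<zero>\<^bsub>A\<^esub>} \<and>
    (\<forall>I J. ideal I A \<longrightarrow> ideal J A \<longrightarrow> C \<subseteq> ideal_coproduct A I J \<longrightarrow> C \<subseteq> I \<or> C \<subseteq> J)"

definition CoSp :: "('a, 'b) ring_scheme \<Rightarrow> 'a set set"
  where "CoSp A = {C. coprime_ideal A C}"

end

theory Submission
  imports Defs
begin

text \<open>In a domain every nonzero ideal \<open>I\<close> has zero annihilator, so \<open>[I : I]\<close> is the whole
  ring and a coprime ideal \<open>C\<close> lies in every nonzero ideal. Pick \<open>c \<noteq> 0\<close> in \<open>C\<close>. For \<open>a \<noteq> 0\<close>
  the ideal generated by \<open>a c\<close> then contains \<open>c\<close>, say \<open>c = d a c\<close>; cancelling \<open>c\<close> gives \<open>d a = 1\<close>.\<close>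

text \<open>An annihilating element kills the witness \<open>i\<close> in particular, and a domain
  has no zero divisors.\<close>

lemma (in domain) annihilator_nonzero_ideal:
  assumes "ideal I R" "i \<in> I" "i \<noteq> \<zero>"
  shows "annihilator R I \<subseteq> {\<zero>}"
proof
  fix x assume x: "x \<in> annihilator R I"
  then have "x \<in> carrier R" "x \<otimes> i = \<zero>"
    using assms(2) by (auto simp: annihilator_def l_coset_def)
  moreover have "i \<in> carrier R"
    using assms(1,2) by (rule ideal.Icarr)
  ultimately show "x \<in> {\<zero>}"
    using assms(3) integral by auto
qed

lemma (in domain) ideal_coproduct_nonzero_ideal:
  assumes "ideal I R" "i \<in> I" "i \<noteq> \<zero>" "ideal J R"
  shows "ideal_coproduct R I J = carrier R"
proof -
  \<comment> \<open>Here \<open>x\<close> must be zero, so the product is zero and lies in every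
    ideal.\<close>
  have "a \<otimes> x \<in> J" if "a \<in> carrier R" "x \<in> annihilator R I" for a x
    using annihilator_nonzero_ideal[OF assms(1-3)] that
      additive_subgroup.zero_closed[OF ideal.axioms(1)[OF assms(4)]] by auto
  then show ?thesis
    unfolding ideal_coproduct_def ideal_colon_def l_coset_def by blast
qed

lemma (in domain) coprime_ideal_subset_nonzero_ideal:
  assumes "coprime_ideal R C" "ideal I R" "i \<in> I" "i \<noteq> \<zero>"
  shows "C \<subseteq> I"
proof -
  \<comment> \<open>With both ideals equal to \<open>I\<close>, the two alternatives of coprimality
    coincide.\<close>
  have "C \<subseteq> ideal_coproduct R I I"
    unfolding ideal_coproduct_nonzero_ideal[OF assms(2-4) assms(2)]
    using assms(1) ideal.Icarr by (metis coprime_ideal_def subsetI)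
  then show ?thesis
    using assms(1,2) unfolding coprime_ideal_def by blast
qed

theorem corollary2:
  fixes D :: "('a, 'b) ring_scheme"
  assumes "domain D"
    and "CoSp D \<noteq> {}"
  shows "field D"
proof -
  interpret domain D by fact
  obtain C where C: "coprime_ideal D C"
    using assms(2) by (auto simp: CoSp_def)
  then have "ideal C D" "C \<noteq> {\<zero>\<^bsub>D\<^esub>}"
    by (auto simp: coprime_ideal_def)
  then obtain c where "c \<in> C" "c \<noteq> \<zero>\<^bsub>D\<^esub>"
    using additive_subgroup.zero_closed[OF ideal.axioms(1)[OF \<open>ideal C D\<close>]] by blast
  then have c: "c \<in> C" "c \<noteq> \<zero>\<^bsub>D\<^esub>" "c \<in> carrier D"
    using ideal.Icarr[OF \<open>ideal C D\<close>] by auto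
  have "a \<in> Units D" if a: "a \<in> carrier D" "a \<noteq> \<zero>\<^bsub>D\<^esub>" for a
  proof -
    have ac: "a \<otimes>\<^bsub>D\<^esub> c \<in> carrier D" "a \<otimes>\<^bsub>D\<^esub> c \<noteq> \<zero>\<^bsub>D\<^esub>"
      using a c integral by auto
    have "C \<subseteq> PIdl\<^bsub>D\<^esub> (a \<otimes>\<^bsub>D\<^esub> c)"
      using C cgenideal_ideal[OF ac(1)] cgenideal_self[OF ac(1)] ac(2)
      by (rule coprime_ideal_subset_nonzero_ideal)
    with c obtain d where d: "d \<in> carrier D" "c = d \<otimes>\<^bsub>D\<^esub> (a \<otimes>\<^bsub>D\<^esub> c)"
      unfolding cgenideal_def by blast
    \<comment> \<open>Writing \<open>c\<close> as a multiple of itself by one prepares the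
      cancellation.\<close>
    then have "(d \<otimes>\<^bsub>D\<^esub> a) \<otimes>\<^bsub>D\<^esub> c = \<one>\<^bsub>D\<^esub> \<otimes>\<^bsub>D\<^esub> c"
      using m_assoc[OF d(1) a(1) c(3)] l_one[OF c(3)] by metis
    then have "d \<otimes>\<^bsub>D\<^esub> a = \<one>\<^bsub>D\<^esub>"
      using m_rcancel[OF c(2,3)] a d(1) by simp
    then show ?thesis
      using a(1) d(1) m_comm[of d a] unfolding Units_def by auto
  qed
  \<comment> \<open>\<open>cring_fieldI\<close> asks for the exact set of units, so zero must be
    excluded; this holds as zero and one differ in a domain.\<close>
  moreover have "\<zero>\<^bsub>D\<^esub> \<notin> Units D"
    using zero_not_one by (auto simp: Units_def)
  ultimately have "Units D = carrier D - {\<zero>\<^bsub>D\<^esub>}"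
    using Units_closed by blast
  then show ?thesis
    by (rule cring_fieldI)
qed

end
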